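(* Let $V$ be a $\mathbf{Z}$-graded $L$-module of the intermediate series, where $L$ is the centerless $q$-analog Virasoro-like algebra. Then $V$ is isomorphic to one of $V(a,I)$, $V(a,II)$, $V(a,III)$, $V(a,IV)$ for some $a\in\mathbf{C}^*$, or $V$ is isomorphic to a direct sum of some trivial $L$-modules.
   Context: All vector spaces are over $\mathbf{C}$; $\mathbf{C}^*$ denotes the nonzero complex numbers. Fix $q\in\mathbf{C}$ nonzero and not a root of unity. The centerless $q$-analog Virasoro-like algebra $L$ is the Lie algebra over $\mathbf{C}$ with basis the symbols $t_1^h t_2^j$, $(h,j)\in\mathbf{Z}^2\setminus\{(0,0)\}$, and bracket $[t_1^h t_2^j, t_1^m t_2^n]=(q^{jm}-q^{hn})\,t_1^{h+m}t_2^{j+n}$ (when $(h+m,j+n)=(0,0)$ the coefficient is $0$ and the bracket is $0$). It is $\mathbf{Z}$-graded by $L=\bigoplus_{u\in\mathbf{Z}}L_u$, where $L_u$ is the span of the basis elements $t_1^u t_2^j$, $j\in\mathbf{Z}$ (with $(u,j)\neq(0,0)$). A $\mathbf{Z}$-graded $L$-module of the intermediate series is an $L$-module $V$ with a vector space decomposition $V=\bigoplus_{n\in\mathbf{Z}}V_n$ such that $L_u.V_n\subseteq V_{n+u}$ for all $u,n\in\mathbf{Z}$ and $\dim V_n\le 1$ for all $n\in\mathbf{Z}$. A trivial $L$-module is one on which every element of $L$ acts as $0$. For $a\in\mathbf{C}^*$, the modules $V(a,I),V(a,II),V(a,III),V(a,IV)$ all have underlying vector space with basis $\{v_k\mid k\in\mathbf{Z}\}$,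 graded by $V_n=\mathbf{C}v_n$, with $L$-action given, for all $(m,n)\in\mathbf{Z}^2\setminus\{(0,0)\}$ and $k\in\mathbf{Z}$, by: $V(a,I)$: $(t_1^m t_2^n).v_k=(aq^k)^n v_{k+m}$; $V(a,II)$: $(t_1^m t_2^n).v_k=(-1)^m(aq^k)^n v_{k+m}$; $V(a,III)$: $(t_1^m t_2^n).v_k=(-1)^{m+n+1}(aq^{-k-m})^n v_{k+m}$; $V(a,IV)$: $(t_1^m t_2^n).v_k=(-1)^{n+1}(aq^{-k-m})^n v_{k+m}$. *)

theory Defs
  imports Complex_Main "HOL-Library.Poly_Mapping"
begin

text \<open>
  A finitely supported map \<open>x :: int \<times> int \<Rightarrow>\<^sub>0 complex\<close> stands for the linear combination of the
  symbols \<open>t\<^sub>1\<^sup>h t\<^sub>2\<^sup>j\<close> with coefficients \<open>lookup x (h, j)\<close>; the symbol itself is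
  \<open>single (h, j) 1\<close>.
\<close>

definition fscale :: "complex \<Rightarrow> ('i \<Rightarrow>\<^sub>0 complex) \<Rightarrow> ('i \<Rightarrow>\<^sub>0 complex)" where
  "fscale c x = Poly_Mapping.map (\<lambda>b. c * b) x"

definition qvir :: "(int \<times> int \<Rightarrow>\<^sub>0 complex) set" where
  "qvir = {x. (0, 0) \<notin> Poly_Mapping.keys x}"

definition qvir_deg :: "int \<Rightarrow> (int \<times> int \<Rightarrow>\<^sub>0 complex) set" where
  "qvir_deg u = {x \<in> qvir. \<forall>p \<in> Poly_Mapping.keys x. fst p = u}"

text \<open>
  The bilinear extension of the bracket on the symbols. If \<open>(h + m, j + n) = (0, 0)\<close>, the
  coefficient vanishes, so the bracket stays inside \<^const>\<open>qvir\<close>.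
\<close>

definition qvir_bracket ::
  "complex \<Rightarrow> (int \<times> int \<Rightarrow>\<^sub>0 complex) \<Rightarrow> (int \<times> int \<Rightarrow>\<^sub>0 complex) \<Rightarrow> (int \<times> int \<Rightarrow>\<^sub>0 complex)" where
  "qvir_bracket q x y =
     (\<Sum>(h, j) \<in> Poly_Mapping.keys x. \<Sum>(m, n) \<in> Poly_Mapping.keys y.
        Poly_Mapping.single (h + m, j + n)
          (Poly_Mapping.lookup x (h, j) * Poly_Mapping.lookup y (m, n) * (q powi (j * m) - q powi (h * n))))"

lemma qvir_bracket_symbols:
  "qvir_bracket q (Poly_Mapping.single (h, j) 1) (Poly_Mapping.single (m, n) 1) =
     Poly_Mapping.single (h + m, j + n) (q powi (j * m) - q powi (h * n))"
  by (simp add: qvir_bracket_def)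

lemma qvir_bracket_closed:
  assumes "q \<noteq> 0"
  shows "qvir_bracket q x y \<in> qvir"
proof -
  have *: "q powi (j * m) - q powi (h * n) = 0" if "h + m = 0" "j + n = 0" for h j m n :: int
  proof -
    have "m = - h" "n = - j" using that by auto
    then show ?thesis by (simp add: mult.commute)
  qed
  have "Poly_Mapping.lookup (qvir_bracket q x y) (0, 0) = 0"
    unfolding qvir_bracket_def lookup_sum case_prod_beta
    by (intro sum.neutral ballI) (auto simp: lookup_single when_def *)
  then show ?thesis by (simp add: qvir_def in_keys_iff)
qed

text \<open>
  The module is the whole type \<open>'v\<close>, with complex scalar multiplication \<open>scale\<close>. The values
  \<open>act x v\<close> for \<open>x \<notin> qvir\<close> are irrelevant.
\<close>

locale qvir_module = vector_space scale
  for scale :: "complex \<Rightarrow> 'v::ab_group_add \<Rightarrow> 'v" +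
  fixes q :: complex
    and act :: "(int \<times> int \<Rightarrow>\<^sub>0 complex) \<Rightarrow> 'v \<Rightarrow> 'v"
  assumes act_add_left: "\<lbrakk>x \<in> qvir; y \<in> qvir\<rbrakk> \<Longrightarrow> act (x + y) v = act x v + act y v"
    and act_scale_left: "x \<in> qvir \<Longrightarrow> act (fscale c x) v = scale c (act x v)"
    and act_add_right: "x \<in> qvir \<Longrightarrow> act x (v + w) = act x v + act x w"
    and act_scale_right: "x \<in> qvir \<Longrightarrow> act x (scale c v) = scale c (act x v)"
    and act_bracket: "\<lbrakk>x \<in> qvir; y \<in> qvir\<rbrakk> \<Longrightarrow>
      act (qvir_bracket q x y) v = act x (act y v) - act y (act x v)"

definition direct_sum_of ::
  "(complex \<Rightarrow> 'v::ab_group_add \<Rightarrow> 'v) \<Rightarrow> 'i set \<Rightarrow> ('i \<Rightarrow> 'v set) \<Rightarrow> bool" where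
  "direct_sum_of scale I W \<longleftrightarrow>
     (\<forall>i \<in> I. module.subspace scale (W i)) \<and>
     (\<forall>v. \<exists>!f :: 'i \<Rightarrow>\<^sub>0 'v. Poly_Mapping.keys f \<subseteq> I \<and> (\<forall>i \<in> I. Poly_Mapping.lookup f i \<in> W i) \<and>
        v = (\<Sum>i \<in> Poly_Mapping.keys f. Poly_Mapping.lookup f i))"

text \<open>
  \<^const>\<open>vector_space.dim\<close> is 0 on spaces of infinite dimension, so that finite dimension has to be
  required separately.
\<close>

locale qvir_intermediate_series = qvir_module scale q act
  for scale :: "complex \<Rightarrow> 'v::ab_group_add \<Rightarrow> 'v"
    and q :: complex
    and act :: "(int \<times> int \<Rightarrow>\<^sub>0 complex) \<Rightarrow> 'v \<Rightarrow> 'v" +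
  fixes V :: "int \<Rightarrow> 'v set"
  assumes decomposition: "direct_sum_of scale UNIV V"
    and graded_action: "\<lbrakk>x \<in> qvir_deg u; v \<in> V n\<rbrakk> \<Longrightarrow> act x v \<in> V (n + u)"
    and finite_dim: "\<exists>B. finite B \<and> V n \<subseteq> span B"
    and dim_le_1: "dim (V n) \<le> 1"

definition qvir_graded_iso ::
  "(complex \<Rightarrow> 'v::ab_group_add \<Rightarrow> 'v) \<Rightarrow> ((int \<times> int \<Rightarrow>\<^sub>0 complex) \<Rightarrow> 'v \<Rightarrow> 'v) \<Rightarrow> (int \<Rightarrow> 'v set) \<Rightarrow>
   (complex \<Rightarrow> 'w::ab_group_add \<Rightarrow> 'w) \<Rightarrow> ((int \<times> int \<Rightarrow>\<^sub>0 complex) \<Rightarrow> 'w \<Rightarrow> 'w) \<Rightarrow> (int \<Rightarrow> 'w set) \<Rightarrow>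
   bool" where
  "qvir_graded_iso scale act V scale' act' V' \<longleftrightarrow>
     (\<exists>f. Vector_Spaces.linear scale scale' f \<and> bij f \<and>
        (\<forall>x \<in> qvir. \<forall>v. f (act x v) = act' x (f v)) \<and>
        (\<forall>n. f ` V n = V' n))"

definition qvir_graded_submodule ::
  "(complex \<Rightarrow> 'v::ab_group_add \<Rightarrow> 'v) \<Rightarrow> ((int \<times> int \<Rightarrow>\<^sub>0 complex) \<Rightarrow> 'v \<Rightarrow> 'v) \<Rightarrow> (int \<Rightarrow> 'v set) \<Rightarrow>
   'v set \<Rightarrow> bool" where
  "qvir_graded_submodule scale act V W \<longleftrightarrow>
     module.subspace scale W \<and> (\<forall>x \<in> qvir. \<forall>w \<in> W. act x w \<in> W) \<and>
     W \<subseteq> module.span scale (\<Union>n. W \<inter> V n)"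

text \<open>
  Isomorphic to an external direct sum of trivial modules means being the internal direct sum of
  trivial submodules (the images of the summands). A set of submodules suffices as index, since
  the summands other than 0 in an internal direct sum are pairwise distinct.
\<close>

definition direct_sum_of_trivial_modules ::
  "(complex \<Rightarrow> 'v::ab_group_add \<Rightarrow> 'v) \<Rightarrow> ((int \<times> int \<Rightarrow>\<^sub>0 complex) \<Rightarrow> 'v \<Rightarrow> 'v) \<Rightarrow> (int \<Rightarrow> 'v set) \<Rightarrow>
   bool" where
  "direct_sum_of_trivial_modules scale act V \<longleftrightarrow>
     (\<exists>\<W> :: 'v set set.
        (\<forall>W \<in> \<W>. qvir_graded_submodule scale act V W \<and> (\<forall>x \<in> qvir. \<forall>w \<in> W. act x w = 0)) \<and>
        direct_sum_of scale \<W> (\<lambda>W. W))"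

text \<open>
  The underlying space is \<open>int \<Rightarrow>\<^sub>0 complex\<close> with \<open>v\<^sub>k = single k 1\<close>. The action is the bilinear
  extension of \<open>(t\<^sub>1\<^sup>m t\<^sub>2\<^sup>n).v\<^sub>k = c m n k \<cdot> v\<^bsub>k+m\<^esub>\<close>.
\<close>

definition shift_act ::
  "(int \<Rightarrow> int \<Rightarrow> int \<Rightarrow> complex) \<Rightarrow> (int \<times> int \<Rightarrow>\<^sub>0 complex) \<Rightarrow> (int \<Rightarrow>\<^sub>0 complex) \<Rightarrow> (int \<Rightarrow>\<^sub>0 complex)"
  where
  "shift_act c x v =
     (\<Sum>(m, n) \<in> Poly_Mapping.keys x. \<Sum>k \<in> Poly_Mapping.keys v.
        Poly_Mapping.single (k + m) (Poly_Mapping.lookup x (m, n) * Poly_Mapping.lookup v k * c m n k))"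

lemma shift_act_symbols:
  "shift_act c (Poly_Mapping.single (m, n) 1) (Poly_Mapping.single k 1) =
     Poly_Mapping.single (k + m) (c m n k)"
  by (simp add: shift_act_def)

definition act_I where
  "act_I q a = shift_act (\<lambda>m n k. (a * q powi k) powi n)"

definition act_II where
  "act_II q a = shift_act (\<lambda>m n k. (-1) powi m * (a * q powi k) powi n)"

definition act_III where
  "act_III q a = shift_act (\<lambda>m n k. (-1) powi (m + n + 1) * (a * q powi (- k - m)) powi n)"

definition act_IV where
  "act_IV q a = shift_act (\<lambda>m n k. (-1) powi (n + 1) * (a * q powi (- k - m)) powi n)"

definition line :: "int \<Rightarrow> (int \<Rightarrow>\<^sub>0 complex) set" where
  "line n = {fscale c (Poly_Mapping.single n 1) | c. True}"

end

theory Submission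
  imports Defs "HOL-Computational_Algebra.Polynomial"
begin

text \<open>
  Choose a generator \<open>w\<^sub>k\<close> of each \<open>V\<^sub>k\<close> and write \<open>(t\<^sub>1\<^sup>m t\<^sub>2\<^sup>n).w\<^sub>k = A m n k \<cdot> w\<^bsub>k+m\<^esub>\<close>. The module is then
  encoded in the scalars \<open>A m n k\<close>, and the theorem becomes a classification of solutions of a
  quadratic functional equation (locale \<open>qvir_coefficients\<close>, theorem \<open>classification\<close>), with
  \<open>A 0 l k\<close> the weight of \<open>t\<^sub>2\<^sup>l\<close> on \<open>V\<^sub>k\<close>. It is solved as follows.

  The bracket of \<open>t\<^sub>2\<^sup>j\<close> with \<open>t\<^sub>1 t\<^sub>2\<^sup>n\<close> forces \<open>A 1 n k = b\<^sub>k\<^sup>n \<cdot> A 1 0 k\<close> for some \<open>b\<^sub>k \<noteq> 0\<close> (\<open>ratio\<close>).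
  The bracket of \<open>t\<^sub>1\<^sup>-\<^sup>1\<close> with \<open>t\<^sub>1 t\<^sub>2\<^sup>l\<close> then shows two things: the scalar \<open>P\<close> by which \<open>t\<^sub>1\<^sup>-\<^sup>1 t\<^sub>1\<close> acts
  on \<open>V\<^sub>k\<close> does not depend on \<open>k\<close> (\<open>round_trip\<close>), and
  \<open>(1 - q\<^sup>-\<^sup>l) \<cdot> A 0 l k = P \<cdot> (b\<^sub>k\<^sup>l - b\<^bsub>k-1\<^esub>\<^sup>l)\<close> (\<open>weight_from_ratios\<close>).

  If \<open>P = 0\<close>, all weights vanish. As a nonzero coefficient \<open>A m n k\<close> with \<open>m \<noteq> 0\<close> makes the weights at
  \<open>k\<close> and \<open>k + m\<close> differ, \<open>L\<close> acts by 0.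

  If \<open>P \<noteq> 0\<close>, every \<open>V\<^sub>k\<close> is a line. Comparing the weight formula at \<open>k\<close> and \<open>k + 1\<close> with
  \<open>A 0 l (k+1) - A 0 l k = (q\<^sup>l - 1) b\<^sub>k\<^sup>l\<close> gives a linear relation between the characters
  \<open>l \<mapsto> x\<^sup>l\<close> with \<open>x\<close> one of \<open>b\<^bsub>k+1\<^esub>\<close>, \<open>b\<^bsub>k-1\<^esub>\<close>, \<open>b\<^sub>k\<close>, \<open>q b\<^sub>k\<close>, \<open>b\<^sub>k / q\<close>. Linear independence of
  characters (\<open>four_characters\<close>) leaves only \<open>P = 1\<close> and
  \<open>{b\<^bsub>k+1\<^esub>, b\<^bsub>k-1\<^esub>} = {q b\<^sub>k, b\<^sub>k / q}\<close>. So \<open>b\<close> is a geometric progression with quotient \<open>q\<close> or \<open>1/q\<close>.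
  In the first case \<open>t\<^sub>1\<^sup>m\<close> acts as the \<open>m\<close>-th power of \<open>t\<^sub>1\<close>, and rescaling the \<open>w\<^sub>k\<close> so that \<open>t\<^sub>1\<close> shifts
  them gives \<open>V(a,I)\<close> (\<open>ascending_case\<close>). The second case is the first one for the restricted dual
  module (\<open>dual_coefficients\<close>), and dualizing back gives \<open>V(a,IV)\<close>. Types II and III arise from
  types I and IV, respectively, by rescaling \<open>v\<^sub>k\<close> by \<open>(-1)\<^sup>k\<close>, so two of the four alternatives already cover all modules.
\<close>

section \<open>Recursions over the integers and a relation between characters\<close>

lemma geometric_powi:
  fixes f :: "int \<Rightarrow> complex"
  assumes step: "\<And>n. f (n + 1) = b * f n" and "f 0 \<noteq> 0"
  shows "b \<noteq> 0" and "f n = b powi n * f 0"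
proof -
  show b: "b \<noteq> 0"
    using step[of "-1"] assms(2) by auto
  show "f n = b powi n * f 0"
  proof (induction n rule: int_induct[where k = 0])
    case base
    show ?case by simp
  next
    case (step1 i)
    then show ?case using b by (simp add: step power_int_add)
  next
    case (step2 i)
    have "b * f (i - 1) = b powi i * f 0"
      using step[of "i - 1"] step2 by simp
    then show ?case using b by (simp add: power_int_diff field_simps)
  qed
qed

lemma int_recursion:
  fixes c :: "int \<Rightarrow> complex"
  assumes "\<And>k. c k \<noteq> 0"
  shows "\<exists>r. (\<forall>k. r k \<noteq> 0) \<and> (\<forall>k. r (k + 1) = c k * r k)"
proof -
  define r where "r k = (\<Prod>i\<in>{0..<k}. c i) / (\<Prod>i\<in>{k..<0}. c i)" for k
  have "r (k + 1) = c k * r k" for k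
  proof (cases "k \<ge> 0")
    case True
    then have "{0..<k + 1} = insert k {0..<k}" by auto
    then show ?thesis using True by (simp add: r_def)
  next
    case False
    then have "{k..<0} = insert k {k + 1..<0}" by auto
    then show ?thesis using False assms by (simp add: r_def)
  qed
  moreover have "r k \<noteq> 0" for k
    using assms by (simp add: r_def)
  ultimately show ?thesis by blast
qed

text \<open>
  An instance of the linear independence of the characters \<open>l \<mapsto> x\<^sup>l\<close>: \<open>Q\<close> and \<open>R\<close> are distinct and
  different from 1, so \<open>u\<close> and \<open>v\<close> have to account for them. It is proved by testing the relation
  against polynomials, which also covers coincidences among \<open>u\<close>, \<open>v\<close> and \<open>1\<close>.
\<close>

lemma four_characters:
  fixes P Q R u v :: complex
  assumes eq: "\<And>l::nat. P * u ^ l + P * v ^ l - (2 * P - 2) = Q ^ l + R ^ l"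
    and QR: "Q * R = 1" "Q \<noteq> R"
  shows "P = 1 \<and> (u = Q \<and> v = R \<or> u = R \<and> v = Q)"
proof -
  have poly: "P * poly f u + P * poly f v - (2 * P - 2) * poly f 1 = poly f Q + poly f R" for f
  proof -
    have "P * poly f u + P * poly f v - (2 * P - 2) * poly f 1
        = (\<Sum>i\<le>degree f. coeff f i * (P * u ^ i + P * v ^ i - (2 * P - 2)))"
      by (simp add: poly_altdef sum_distrib_left sum_distrib_right sum.distrib sum_subtractf algebra_simps)
    also have "\<dots> = poly f Q + poly f R"
      by (simp only: eq) (simp add: poly_altdef sum.distrib algebra_simps)
    finally show ?thesis .
  qed
  have "Q \<noteq> 1" "R \<noteq> 1" using QR by auto
  \<comment> \<open>A quartic that kills every term except one: if \<open>Q\<close> were neither \<open>u\<close> nor \<open>v\<close>, the quartic with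
    \<open>c = R\<close> would not vanish at \<open>Q\<close>, although it vanishes at all the other bases.\<close>
  have quartic: "poly ([:-1, 1:] * [:-u, 1:] * [:-v, 1:] * [:-c, 1:]) x
      = (x - 1) * (x - u) * (x - v) * (x - c)" for c x
    by (simp only: poly_mult) simp
  have "Q = u \<or> Q = v"
    using poly[of "[:-1, 1:] * [:-u, 1:] * [:-v, 1:] * [:-R, 1:]", unfolded quartic] QR \<open>Q \<noteq> 1\<close>
    by simp
  moreover have "R = u \<or> R = v"
    using poly[of "[:-1, 1:] * [:-u, 1:] * [:-v, 1:] * [:-Q, 1:]", unfolded quartic] QR \<open>R \<noteq> 1\<close>
    by simp
  ultimately have uv: "u = Q \<and> v = R \<or> u = R \<and> v = Q"
    using QR by auto
  then have "(P - 1) * (Q + R - 2) = 0"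
    using eq[of 1] by (auto simp: algebra_simps)
  moreover have "Q + R - 2 \<noteq> 0"
  proof
    assume "Q + R - 2 = 0"
    then have "R = 2 - Q" by (simp add: algebra_simps)
    then have "(Q - 1) * (Q - 1) = 0" using QR(1) by algebra
    then show False using \<open>Q \<noteq> 1\<close> by simp
  qed
  ultimately show ?thesis using uv by simp
qed

section \<open>Classification of the structure coefficients\<close>

text \<open>
  The value \<open>A 0 0 k\<close> belongs to no symbol and is arbitrary. It enters the bracket relation only if
  \<open>(h + m, j + n) = (0, 0)\<close>, where its factor is 0.
\<close>

locale qvir_coefficients =
  fixes q :: complex and A :: "int \<Rightarrow> int \<Rightarrow> int \<Rightarrow> complex"
  assumes q_nonzero: "q \<noteq> 0"
    and q_powi: "q powi l = 1 \<longleftrightarrow> l = 0"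
    and bracket: "\<lbrakk>(h, j) \<noteq> (0, 0); (m, n) \<noteq> (0, 0)\<rbrakk> \<Longrightarrow>
      A h j (k + m) * A m n k - A m n (k + h) * A h j k
        = (q powi (j * m) - q powi (h * n)) * A (h + m) (j + n) k"
begin

lemma bracket_degree_zero:
  assumes "m \<noteq> 0" "j \<noteq> 0"
  shows "(A 0 j (k + m) - A 0 j k) * A m n k = (q powi (j * m) - 1) * A m (n + j) k"
  using bracket[of 0 j m n k] assms by (simp add: algebra_simps)

text \<open>
  By the bracket with \<open>t\<^sub>2\<close>, passing from \<open>t\<^sub>1 t\<^sub>2\<^sup>n\<close> to \<open>t\<^sub>1 t\<^sub>2\<^sup>n\<^sup>+\<^sup>1\<close> multiplies the coefficient by a number
  that depends on the weights of \<open>t\<^sub>2\<close> at \<open>k\<close> and \<open>k + 1\<close> but not on \<open>n\<close>.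
\<close>

lemma ex_ratio: "\<exists>b. b \<noteq> 0 \<and> (\<forall>n. A 1 n k = b powi n * A 1 0 k)"
proof (cases "A 1 0 k = 0")
  case True
  then have "A 1 n k = 0" for n
    using bracket_degree_zero[of 1 n k 0] q_powi[of n] by (cases "n = 0") auto
  then show ?thesis by (intro exI[of _ 1]) simp
next
  case False
  define b where "b = (A 0 1 (k + 1) - A 0 1 k) / (q - 1)"
  have "q \<noteq> 1" using q_powi[of 1] by simp
  then have "A 1 (n + 1) k = b * A 1 n k" for n
    using bracket_degree_zero[of 1 1 k n] by (simp add: b_def field_simps)
  from geometric_powi[of "\<lambda>n. A 1 n k", OF this False] show ?thesis by blast
qed

definition ratio :: "int \<Rightarrow> complex" where
  "ratio k = (SOME b. b \<noteq> 0 \<and> (\<forall>n. A 1 n k = b powi n * A 1 0 k))"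

lemma ratio_nonzero: "ratio k \<noteq> 0"
  and ratio: "A 1 n k = ratio k powi n * A 1 0 k"
  using someI_ex[OF ex_ratio, of k] unfolding ratio_def by blast+

text \<open>
  The scalar of \<open>t\<^sub>1\<^sup>-\<^sup>1 t\<^sub>1\<close> on \<open>V\<^sub>0\<close>. On \<open>V\<^sub>k\<close> the scalar equals the scalar of \<open>t\<^sub>1 t\<^sub>1\<^sup>-\<^sup>1\<close>,
  because \<open>[t\<^sub>1\<^sup>-\<^sup>1, t\<^sub>1] = 0\<close>, and this is the scalar of \<open>t\<^sub>1\<^sup>-\<^sup>1 t\<^sub>1\<close> on \<open>V\<^bsub>k-1\<^esub>\<close>; so it is the same for all \<open>k\<close>.
\<close>

definition round_trip :: complex where
  "round_trip = A (-1) 0 1 * A 1 0 0"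

lemma round_trip: "A (-1) 0 (k + 1) * A 1 0 k = round_trip"
proof -
  have step: "A (-1) 0 (k + 1) * A 1 0 k = A (-1) 0 k * A 1 0 (k - 1)" for k
    using bracket[of "-1" 0 1 0 k] by simp
  show ?thesis
  proof (induction k rule: int_induct[where k = 0])
    case base
    show ?case by (simp add: round_trip_def)
  next
    case (step1 i)
    then show ?case using step[of "i + 1"] by simp
  next
    case (step2 i)
    then show ?case using step[of i] by simp
  qed
qed

text \<open>The bracket of \<open>t\<^sub>1\<^sup>-\<^sup>1\<close> with \<open>t\<^sub>1 t\<^sub>2\<^sup>l\<close> is \<open>(1 - q\<^sup>-\<^sup>l) t\<^sub>2\<^sup>l\<close>.\<close>

lemma weight_from_ratios:
  "(1 - q powi (- l)) * A 0 l k = round_trip * (ratio k powi l - ratio (k - 1) powi l)"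
proof -
  have "(1 - q powi (- l)) * A 0 l k
      = A (-1) 0 (k + 1) * A 1 l k - A 1 l (k - 1) * A (-1) 0 k"
    using bracket[of "-1" 0 1 l k] by (simp add: algebra_simps)
  also have "\<dots> = (A (-1) 0 (k + 1) * A 1 0 k) * ratio k powi l
      - (A (-1) 0 k * A 1 0 (k - 1)) * ratio (k - 1) powi l"
    by (subst (1 2) ratio) (simp add: algebra_simps)
  also have "\<dots> = round_trip * (ratio k powi l - ratio (k - 1) powi l)"
    using round_trip[of k] round_trip[of "k - 1"] by (simp add: right_diff_distrib)
  finally show ?thesis .
qed

lemma trivial_if_round_trip_zero:
  assumes "round_trip = 0" "(m, n) \<noteq> (0, 0)"
  shows "A m n k = 0"
proof -
  have weight0: "A 0 l k = 0" if "l \<noteq> 0" for l k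
    using weight_from_ratios[of l k] assms(1) that q_powi[of "- l"] by auto
  show ?thesis
  proof (cases "m = 0")
    case True
    then show ?thesis using weight0 assms(2) by simp
  next
    case False
    then show ?thesis
      using bracket_degree_zero[of m 1 k "n - 1"] weight0 q_powi[of m] by auto
  qed
qed

context
  assumes nontrivial: "round_trip \<noteq> 0"
begin

lemma A_1_nonzero: "A 1 0 k \<noteq> 0"
  using round_trip[of k] nontrivial by auto

lemma weight_step: "A 0 l (k + 1) - A 0 l k = (q powi l - 1) * ratio k powi l" if "l \<noteq> 0"
  using bracket_degree_zero[of 1 l k 0] that A_1_nonzero[of k] ratio[of l k] by simp

lemma q_neq_inverse: "q \<noteq> 1 / q"
proof
  assume "q = 1 / q"
  then have "q * q = 1" using q_nonzero by (metis nonzero_eq_divide_eq)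
  then show False using q_powi[of 2] by (simp add: power2_eq_square)
qed

text \<open>
  The difference of \<open>weight_from_ratios\<close> at \<open>k + 1\<close> and at \<open>k\<close> is evaluated by \<open>weight_step\<close>;
  division by \<open>ratio k ^ l\<close> turns the result into the hypothesis of \<open>four_characters\<close>.
\<close>

lemma neighbouring_ratios:
  "round_trip = 1 \<and>
   (ratio (k + 1) = q * ratio k \<and> ratio (k - 1) = ratio k / q \<or>
    ratio (k + 1) = ratio k / q \<and> ratio (k - 1) = q * ratio k)"
proof -
  let ?u = "ratio (k + 1) / ratio k" and ?v = "ratio (k - 1) / ratio k"
  have "round_trip * ?u ^ l + round_trip * ?v ^ l - (2 * round_trip - 2) = q ^ l + (1 / q) ^ l"
    for l :: nat
  proof (cases "l = 0")
    case False
    let ?x = "\<lambda>i. ratio i ^ l"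
    define Q x y z where "Q = q ^ l" and "x = ratio (k - 1) ^ l" and "y = ratio k ^ l"
      and "z = ratio (k + 1) ^ l"
    note abbrev = Q_def x_def y_def z_def
    have nonzero: "Q \<noteq> 0" "y \<noteq> 0" using q_nonzero ratio_nonzero by (auto simp: abbrev)
    have "(1 - 1 / Q) * ((Q - 1) * y) = (1 - 1 / Q) * (A 0 (int l) (k + 1) - A 0 (int l) k)"
      using weight_step[of "int l" k] False by (simp add: abbrev)
    also have "\<dots> = round_trip * (z - y) - round_trip * (y - x)"
      using weight_from_ratios[of "int l" "k + 1"] weight_from_ratios[of "int l" k]
      by (simp add: abbrev power_int_minus right_diff_distrib inverse_eq_divide)
    finally have "round_trip * (z - y) - round_trip * (y - x) = (1 - 1 / Q) * ((Q - 1) * y)" ..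
    then have "round_trip * (z / y) + round_trip * (x / y) - (2 * round_trip - 2) = Q + 1 / Q"
      using nonzero by (simp add: field_simps)
    then show ?thesis by (simp add: abbrev power_divide)
  qed simp
  from four_characters[OF this _ q_neq_inverse]
  have "round_trip = 1 \<and> (?u = q \<and> ?v = 1 / q \<or> ?u = 1 / q \<and> ?v = q)"
    using q_nonzero by simp
  then show ?thesis
    using ratio_nonzero[of k] by (simp add: divide_eq_eq)
qed

lemma round_trip_eq_1: "round_trip = 1"
  using neighbouring_ratios by blast

text \<open>
  The direction cannot change along the progression: if \<open>ratio\<close> were multiplied by \<open>q\<close> from \<open>k\<close> to
  \<open>k + 1\<close> and divided by \<open>q\<close> from \<open>k + 1\<close> to \<open>k + 2\<close>, both neighbours of \<open>ratio (k + 1)\<close> would be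
  \<open>ratio (k + 1) / q\<close>, but one of them is \<open>q * ratio (k + 1)\<close>. The other order fails in the same way.
\<close>

lemma ratio_progression:
  "(\<forall>k. ratio (k + 1) = q * ratio k) \<or> (\<forall>k. ratio (k + 1) = ratio k / q)"
proof -
  have step: "ratio (k + 1 + 1) = q * ratio (k + 1) \<longleftrightarrow> ratio (k + 1) = q * ratio k" for k
  proof -
    have "q * ratio (k + 1) \<noteq> ratio (k + 1) / q"
      using q_neq_inverse ratio_nonzero[of "k + 1"] by (metis mult_cancel_right times_divide_eq_left mult_1)
    moreover have "ratio (k + 1) = q * ratio k \<longleftrightarrow> ratio k = ratio (k + 1) / q"
      using q_nonzero by (metis nonzero_mult_div_cancel_left nonzero_eq_divide_eq mult.commute)
    ultimately show ?thesis
      using neighbouring_ratios[of "k + 1"] by (metis add_diff_cancel)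
  qed
  have "ratio (k + 1) = q * ratio k \<longleftrightarrow> ratio (0 + 1) = q * ratio 0" for k
  proof (induction k rule: int_induct[where k = 0])
    case (step1 i)
    then show ?case using step[of i] by blast
  next
    case (step2 i)
    then show ?case using step[of "i - 1"] by simp
  qed simp
  then show ?thesis using neighbouring_ratios by blast
qed

text \<open>
  An ascending progression makes the weight of \<open>t\<^sub>2\<^sup>l\<close> equal to \<open>ratio k powi l\<close>. Hence the dependence
  of \<open>A m n k\<close> on \<open>n\<close> is known, and only the coefficients of the powers of \<open>t\<^sub>1\<close> remain.
\<close>

lemma ascending_case:
  assumes ascending: "\<And>k. ratio (k + 1) = q * ratio k"
  shows "\<exists>\<alpha> r. \<alpha> \<noteq> 0 \<and> (\<forall>k. r k \<noteq> 0) \<and>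
    (\<forall>m n k. (m, n) \<noteq> (0, 0) \<longrightarrow> A m n k * r k = (\<alpha> * q powi k) powi n * r (k + m))"
proof -
  have ratio_eq: "ratio k = ratio 0 * q powi k" for k
    unfolding mult.commute[of "ratio 0"] by (rule geometric_powi(2)[of ratio, OF ascending ratio_nonzero])
  have ratio_shift: "ratio (k + m) = q powi m * ratio k" for k m
    using q_nonzero ratio_eq[of "k + m"] ratio_eq[of k] by (simp add: power_int_add)
  have weight_eq: "A 0 l k = ratio k powi l" if "l \<noteq> 0" for l k
  proof -
    have "ratio (k - 1) powi l = q powi (- l) * ratio k powi l"
      using ratio_shift[of k "-1"]
      by (simp add: power_int_mult_distrib power_int_minus power_int_divide_distrib field_simps)
    then have "(1 - q powi (- l)) * A 0 l k = (1 - q powi (- l)) * ratio k powi l"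
      using weight_from_ratios[of l k] round_trip_eq_1 by (simp add: left_diff_distrib)
    then show ?thesis using q_powi[of "- l"] that by auto
  qed
  have A_eq: "A m n k = ratio k powi n * A m 0 k" if "m \<noteq> 0" for m n k
  proof (cases "n = 0")
    case False
    have "(q powi (n * m) - 1) * A m n k = (ratio (k + m) powi n - ratio k powi n) * A m 0 k"
      using bracket_degree_zero[of m n k 0] weight_eq that False by simp
    also have "ratio (k + m) powi n = q powi (n * m) * ratio k powi n"
      by (simp add: ratio_shift power_int_mult_distrib power_int_mult mult.commute)
    finally have "(q powi (n * m) - 1) * A m n k = (q powi (n * m) - 1) * (ratio k powi n * A m 0 k)"
      by (simp add: left_diff_distrib)
    then show ?thesis using q_powi[of "n * m"] that False by simp
  qed simp
  \<comment> \<open>The coefficients of \<open>t\<^sub>1\<^sup>m\<close>, with \<open>t\<^sub>1\<^sup>0\<close>, which is not in \<open>L\<close>, taken to act as the identity. This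
    makes \<open>a_Suc\<close> true at \<open>m = 0\<close> and, since the round trip is 1, also at \<open>m = -1\<close>.\<close>
  define a where "a m k = (if m = 0 then 1 else A m 0 k)" for m k
  have a_Suc: "a (m + 1) k = A 1 0 (k + m) * a m k" for m k
  proof -
    consider "m = 0" | "m = -1" | "m \<noteq> 0" "m \<noteq> -1" by blast
    then show ?thesis
    proof cases
      case 2
      then show ?thesis
        using round_trip[of "k - 1"] round_trip_eq_1 by (simp add: a_def mult.commute)
    next
      case 3
      \<comment> \<open>\<open>t\<^sub>1\<close> commutes with \<open>t\<^sub>1\<^sup>m\<close>, and \<open>[t\<^sub>1 t\<^sub>2, t\<^sub>1\<^sup>m] = (q\<^sup>m - 1) t\<^sub>1\<^sup>m\<^sup>+\<^sup>1 t\<^sub>2\<close>.\<close>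
      let ?x = "A 1 0 (k + m) * A m 0 k"
      have "A m 0 (k + 1) * A 1 0 k = ?x"
        using bracket[of 1 0 m 0 k] 3 by simp
      moreover have "A 1 1 (k + m) * A m 0 k - A m 0 (k + 1) * A 1 1 k = (q powi m - 1) * A (m + 1) 1 k"
        using bracket[of 1 1 m 0 k] 3 by (simp add: add.commute)
      ultimately have "(q powi m - 1) * (ratio k * A (m + 1) 0 k) = (q powi m - 1) * (ratio k * ?x)"
        using A_eq[of 1 1 "k + m"] A_eq[of 1 1 k] A_eq[of "m + 1" 1 k] 3
        by (simp add: ratio_shift algebra_simps)
      then show ?thesis
        using 3 q_powi[of m] ratio_nonzero[of k] by (simp add: a_def)
    qed (simp add: a_def)
  qed
  \<comment> \<open>The rescaling for which \<open>t\<^sub>1\<close> sends \<open>r k \<cdot> w\<^sub>k\<close> to \<open>r (k + 1) \<cdot> w\<^bsub>k+1\<^esub>\<close>.\<close>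
  obtain r where r: "\<And>k. r k \<noteq> 0" "\<And>k. r (k + 1) = A 1 0 k * r k"
    using int_recursion[of "A 1 0"] A_1_nonzero by blast
  have a_eq: "a m k * r k = r (k + m)" for m k
  proof (induction m rule: int_induct[where k = 0])
    case base
    show ?case by (simp add: a_def)
  next
    case (step1 i)
    have "a (i + 1) k * r k = A 1 0 (k + i) * r (k + i)"
      using step1 a_Suc[of i k] by simp
    then show ?case using r(2)[of "k + i"] by (simp add: add.assoc)
  next
    case (step2 i)
    have "A 1 0 (k + (i - 1)) * (a (i - 1) k * r k) = A 1 0 (k + (i - 1)) * r (k + (i - 1))"
      using step2 a_Suc[of "i - 1" k] r(2)[of "k + (i - 1)"] by simp
    then show ?case using A_1_nonzero by simp
  qed
  have "A m n k * r k = (ratio 0 * q powi k) powi n * r (k + m)" if "(m, n) \<noteq> (0, 0)" for m n k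
    using a_eq[of m k] that weight_eq[of n k] A_eq[of m n k] unfolding ratio_eq[symmetric]
    by (cases "m = 0") (simp_all add: a_def)
  then show ?thesis using r(1) ratio_nonzero[of 0] by blast
qed

end

text \<open>
  These are the coefficients of the restricted dual module, where \<open>(x.\<phi>)(v) = - \<phi>(x.v)\<close> and the
  functional dual to \<open>w\<^bsub>-k\<^esub>\<close> has degree \<open>k\<close>.
\<close>

lemma dual_coefficients: "qvir_coefficients q (\<lambda>m n k. - A m n (- k - m))"
proof
  fix h j m n k :: int
  assume "(h, j) \<noteq> (0, 0)" "(m, n) \<noteq> (0, 0)"
  note eq = bracket[OF this, of "- k - m - h"]
  have shift: "- k - m - h + m = - k - h" "- k - m - h + h = - k - m"
    "- (k + m) - h = - k - m - h" "- (k + h) - m = - k - m - h" "- k - (h + m) = - k - m - h"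
    by simp_all
  from eq show "- A h j (- (k + m) - h) * - A m n (- k - m) - - A m n (- (k + h) - m) * - A h j (- k - h)
      = (q powi (j * m) - q powi (h * n)) * - A (h + m) (j + n) (- k - (h + m))"
    unfolding shift by (simp add: algebra_simps)
qed (simp_all add: q_nonzero q_powi)

text \<open>
  A descending progression for \<open>A\<close> is an ascending one for the dual coefficients. Dualizing back
  inverts the rescaling and replaces \<open>\<alpha>\<close> by \<open>- \<alpha>\<close>, which absorbs the sign \<open>-1\<close> into \<open>(-1)\<^sup>n\<^sup>+\<^sup>1\<close>.
\<close>

theorem classification:
  "(\<forall>m n k. (m, n) \<noteq> (0, 0) \<longrightarrow> A m n k = 0) \<or>
   (\<exists>\<alpha> r. \<alpha> \<noteq> 0 \<and> (\<forall>k. r k \<noteq> 0) \<and>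
     ((\<forall>m n k. (m, n) \<noteq> (0, 0) \<longrightarrow> A m n k * r k = (\<alpha> * q powi k) powi n * r (k + m)) \<or>
      (\<forall>m n k. (m, n) \<noteq> (0, 0) \<longrightarrow>
         A m n k * r k = (-1) powi (n + 1) * (\<alpha> * q powi (- k - m)) powi n * r (k + m))))"
proof -
  consider "round_trip = 0"
    | "round_trip \<noteq> 0" "\<And>k. ratio (k + 1) = q * ratio k"
    | "round_trip \<noteq> 0" "\<And>k. ratio (k + 1) = ratio k / q"
    using ratio_progression by blast
  then show ?thesis
  proof cases
    case 1
    then show ?thesis using trivial_if_round_trip_zero by blast
  next
    case 2
    then show ?thesis using ascending_case by blast
  next
    case 3
    interpret dual: qvir_coefficients q "\<lambda>m n k. - A m n (- k - m)"
      by (rule dual_coefficients)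
    have dual_ratio: "dual.ratio k = ratio (- k - 1)" for k
      using dual.ratio[of 1 k] ratio[of 1 "- k - 1"] A_1_nonzero[OF 3(1), of "- k - 1"] by simp
    have nontrivial: "dual.round_trip \<noteq> 0"
      using round_trip[of "-1"] 3(1) by (simp add: dual.round_trip_def)
    have "dual.ratio (k + 1) = q * dual.ratio k" for k
    proof -
      have shift: "- k - 2 + 1 = - k - 1" "- (k + 1) - 1 = - k - 2" by simp_all
      show ?thesis
        using 3(2)[of "- k - 2"] q_nonzero unfolding dual_ratio shift by simp
    qed
    from dual.ascending_case[OF nontrivial this]
    obtain \<alpha> r where \<alpha>: "\<alpha> \<noteq> 0" and r: "\<And>k. r k \<noteq> 0"
      and eq: "\<And>m n k. (m, n) \<noteq> (0, 0) \<Longrightarrow>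
        - A m n (- k - m) * r k = (\<alpha> * q powi k) powi n * r (k + m)"
      by blast
    have "A m n k * (1 / r (- k))
        = (-1) powi (n + 1) * (- \<alpha> * q powi (- k - m)) powi n * (1 / r (- (k + m)))"
      if "(m, n) \<noteq> (0, 0)" for m n k
    proof -
      have sign: "(-1) powi (n + 1) * (- x) powi n = - (x powi n)" for x :: complex
        using power_int_mult_distrib[of "-1" x n]
        by (simp add: power_int_add power_int_mult_distrib[symmetric])
      have "- A m n k * r (- k - m) = (\<alpha> * q powi (- k - m)) powi n * r (- k)"
        using eq[OF that, of "- k - m"] by simp
      then have "A m n k * r (- k - m) = - ((\<alpha> * q powi (- k - m)) powi n * r (- k))"
        by (metis minus_minus mult_minus_left)
      then show ?thesis
        using r[of "- k"] r[of "- k - m"] sign[of "\<alpha> * q powi (- k - m)"]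
        by (simp add: field_simps)
    qed
    moreover have "- \<alpha> \<noteq> 0" "\<forall>k. 1 / r (- k) \<noteq> 0" using \<alpha> r by simp_all
    ultimately show ?thesis
      by (intro disjI2 exI[of _ "- \<alpha>"] exI[of _ "\<lambda>k. 1 / r (- k)"]) blast
  qed
qed

end

section \<open>Linear extension from the symbols\<close>

lemma lookup_fscale: "Poly_Mapping.lookup (fscale c x) p = c * Poly_Mapping.lookup x p"
  by (simp add: fscale_def Poly_Mapping.map.rep_eq when_def)

lemma fscale_single: "fscale c (Poly_Mapping.single p a) = Poly_Mapping.single p (c * a)"
  by (rule poly_mapping_eqI) (simp add: lookup_fscale lookup_single when_def)

lemma vector_space_fscale: "vector_space (fscale :: complex \<Rightarrow> ('i \<Rightarrow>\<^sub>0 complex) \<Rightarrow> _)"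
  by unfold_locales (auto intro!: poly_mapping_eqI simp: lookup_fscale lookup_add algebra_simps)

lemma qvir_add: "\<lbrakk>x \<in> qvir; y \<in> qvir\<rbrakk> \<Longrightarrow> x + y \<in> qvir"
  by (simp add: qvir_def in_keys_iff lookup_add)

lemma qvir_single: "(m, n) \<noteq> (0, 0) \<Longrightarrow> Poly_Mapping.single (m, n) c \<in> qvir"
  by (auto simp: qvir_def in_keys_iff lookup_single when_def)

context qvir_module
begin

definition combination :: "('i \<Rightarrow> 'v) \<Rightarrow> ('i \<Rightarrow>\<^sub>0 complex) \<Rightarrow> 'v" where
  "combination e p = (\<Sum>k\<in>Poly_Mapping.keys p. scale (Poly_Mapping.lookup p k) (e k))"

lemma combination_superset:
  "\<lbrakk>finite S; Poly_Mapping.keys p \<subseteq> S\<rbrakk> \<Longrightarrow> combination e p = (\<Sum>k\<in>S. scale (Poly_Mapping.lookup p k) (e k))"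
  unfolding combination_def by (rule sum.mono_neutral_left) (auto simp: in_keys_iff)

lemma combination_add: "combination e (p + p') = combination e p + combination e p'"
proof -
  let ?S = "Poly_Mapping.keys p \<union> Poly_Mapping.keys p'"
  have "Poly_Mapping.keys (p + p') \<subseteq> ?S" by (rule keys_add)
  then show ?thesis
    by (subst (1 2 3) combination_superset[of ?S])
       (auto simp: lookup_add scale_left_distrib sum.distrib)
qed

lemma combination_single [simp]: "combination e (Poly_Mapping.single k c) = scale c (e k)"
  by (simp add: combination_def)

lemma combination_sum: "combination e (sum f S) = (\<Sum>i\<in>S. combination e (f i))"
  by (induction S rule: infinite_finite_induct) (simp_all add: combination_add, simp_all add: combination_def)

lemma combination_fscale: "combination e (fscale c p) = scale c (combination e p)"
proof -
  have "Poly_Mapping.keys (fscale c p) \<subseteq> Poly_Mapping.keys p"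
    by (auto simp: in_keys_iff lookup_fscale)
  then show ?thesis
    by (subst combination_superset[of "Poly_Mapping.keys p"])
       (simp_all add: combination_def lookup_fscale scale_sum_right)
qed

lemma act_zero_right: "x \<in> qvir \<Longrightarrow> act x 0 = 0"
  using act_scale_right[of x 0 0] by simp

lemma act_zero_left: "act 0 v = 0"
  using act_add_left[of 0 0 v] by (simp add: qvir_def)

lemma act_sum_right: "x \<in> qvir \<Longrightarrow> act x (sum f S) = (\<Sum>i\<in>S. act x (f i))"
  by (induction S rule: infinite_finite_induct) (simp_all add: act_zero_right act_add_right)

lemma act_single:
  "p \<noteq> (0, 0) \<Longrightarrow> act (Poly_Mapping.single p c) v = scale c (act (Poly_Mapping.single p 1) v)"
  using act_scale_left[of "Poly_Mapping.single p 1" c v] qvir_single[of "fst p" "snd p" 1]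
  by (simp add: fscale_single)

lemma act_expand:
  assumes "x \<in> qvir"
  shows "act x v = combination (\<lambda>p. act (Poly_Mapping.single p 1) v) x"
proof -
  let ?s = "\<lambda>p. Poly_Mapping.single p (Poly_Mapping.lookup x p)"
  have partial: "act (sum ?s S) v = (\<Sum>p\<in>S. scale (Poly_Mapping.lookup x p) (act (Poly_Mapping.single p 1) v))
      \<and> sum ?s S \<in> qvir"
    if "finite S" "(0, 0) \<notin> S" for S
    using that
  proof (induction S rule: finite_induct)
    case empty
    show ?case by (simp add: act_zero_left qvir_def)
  next
    case (insert p S)
    then have p: "p \<noteq> (0, 0)" by auto
    then have "?s p \<in> qvir" using qvir_single[of "fst p" "snd p"] by simp
    then show ?case using insert p by (auto simp: act_add_left act_single[OF p, of "Poly_Mapping.lookup x p"] qvir_add)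
  qed
  have "sum ?s (Poly_Mapping.keys x) = x"
    by (rule poly_mapping_eqI) (simp add: lookup_sum lookup_single when_def in_keys_iff)
  then show ?thesis
    using partial[of "Poly_Mapping.keys x"] assms by (simp add: combination_def qvir_def)
qed

end

section \<open>From graded modules to coefficients and back\<close>

context qvir_intermediate_series
begin

lemma subspace_V: "subspace (V n)"
  using decomposition by (simp add: direct_sum_of_def)

lemma unique_homogeneous_components:
  "\<exists>!f. (\<forall>i. Poly_Mapping.lookup f i \<in> V i) \<and> v = (\<Sum>i\<in>Poly_Mapping.keys f. Poly_Mapping.lookup f i)"
  using decomposition by (simp add: direct_sum_of_def)

lemma ex_generator: "\<exists>w. V n = range (\<lambda>c. scale c w)"
proof -
  obtain B where B: "B \<subseteq> V n" "independent B" "V n \<subseteq> span B" "card B = dim (V n)"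
    using basis_exists by blast
  obtain C where "finite C" "V n \<subseteq> span C" using finite_dim by blast
  then have "finite B"
    using independent_span_bound[of C B] B by blast
  moreover have "card B \<le> 1" using B(4) dim_le_1[of n] by simp
  ultimately obtain w where "B = {} \<or> B = {w}"
    by (metis card_le_Suc0_iff_eq is_singletonI' is_singleton_the_elem One_nat_def)
  then have "span B = range (\<lambda>c. scale c w) \<or> span B = range (\<lambda>c. scale c 0)"
  proof
    assume "B = {}"
    then show ?thesis by simp
  next
    assume "B = {w}"
    then show ?thesis by (simp add: span_singleton)
  qed
  moreover have "V n = span B"
    using B(1,3) span_minimal[OF _ subspace_V] by blast
  ultimately show ?thesis by metis
qed

text \<open>The generator is 0 if \<open>V n\<close> is.\<close>

definition generator :: "int \<Rightarrow> 'v" where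
  "generator n = (SOME w. V n = range (\<lambda>c. scale c w))"

lemma V_eq: "V n = range (\<lambda>c. scale c (generator n))"
  unfolding generator_def by (rule someI_ex) (rule ex_generator)

lemma generator_in_V: "generator n \<in> V n"
  by (subst V_eq) (metis rangeI scale_one)

text \<open>
  A coefficient into or out of a zero space is set to 0, so that the bracket relation holds
  regardless of which spaces vanish.
\<close>

definition coefficient :: "int \<Rightarrow> int \<Rightarrow> int \<Rightarrow> complex" where
  "coefficient m n k =
     (if generator k = 0 \<or> generator (k + m) = 0 then 0
      else SOME c. act (Poly_Mapping.single (m, n) 1) (generator k) = scale c (generator (k + m)))"

lemma act_generator:
  assumes "(m, n) \<noteq> (0, 0)"
  shows "act (Poly_Mapping.single (m, n) 1) (generator k) = scale (coefficient m n k) (generator (k + m))"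
proof -
  have "Poly_Mapping.single (m, n) 1 \<in> qvir_deg m"
    using qvir_single[OF assms] by (simp add: qvir_deg_def)
  then have "act (Poly_Mapping.single (m, n) 1) (generator k) \<in> V (k + m)"
    using graded_action generator_in_V by blast
  then have ex: "\<exists>c. act (Poly_Mapping.single (m, n) 1) (generator k) = scale c (generator (k + m))"
    using V_eq[of "k + m"] by auto
  show ?thesis
  proof (cases "generator k = 0 \<or> generator (k + m) = 0")
    case True
    then show ?thesis
      using ex act_zero_right[OF qvir_single[OF assms]] by (auto simp: coefficient_def)
  next
    case False
    then show ?thesis
      using someI_ex[OF ex] by (simp add: coefficient_def)
  qed
qed

lemma act_homogeneous:
  "(m, n) \<noteq> (0, 0) \<Longrightarrow>
   act (Poly_Mapping.single (m, n) 1) (scale c (generator k)) = scale (c * coefficient m n k) (generator (k + m))"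
  by (simp add: act_scale_right qvir_single act_generator)

lemma coefficient_bracket:
  assumes "q \<noteq> 0" "(h, j) \<noteq> (0, 0)" "(m, n) \<noteq> (0, 0)"
  shows "coefficient h j (k + m) * coefficient m n k - coefficient m n (k + h) * coefficient h j k
    = (q powi (j * m) - q powi (h * n)) * coefficient (h + m) (j + n) k"
proof (cases "generator k = 0 \<or> generator (k + m + h) = 0")
  case True
  then show ?thesis by (auto simp: coefficient_def ac_simps)
next
  case False
  let ?t = "\<lambda>m n. Poly_Mapping.single (m, n) 1" and ?c = "q powi (j * m) - q powi (h * n)"
  have "act (qvir_bracket q (?t h j) (?t m n)) (generator k)
      = scale (?c * coefficient (h + m) (j + n) k) (generator (k + m + h))"
  proof (cases "(h + m, j + n) = (0, 0)")
    case True
    then have "m = - h" "n = - j" by auto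
    then show ?thesis
      by (simp add: qvir_bracket_symbols act_zero_left mult.commute)
  next
    case False
    then show ?thesis
      by (simp add: qvir_bracket_symbols act_single[OF False, of ?c] act_generator ac_simps)
  qed
  moreover have "act (qvir_bracket q (?t h j) (?t m n)) (generator k)
      = scale (coefficient h j (k + m) * coefficient m n k - coefficient m n (k + h) * coefficient h j k)
          (generator (k + m + h))"
    using assms(2,3)
    by (simp add: act_bracket qvir_single act_generator act_homogeneous scale_left_diff_distrib ac_simps)
  ultimately show ?thesis
    using False by simp
qed

text \<open>
  The isomorphism is the inverse of \<^term>\<open>combination e\<close>. That map is bijective because the family
  of homogeneous components of a vector exists and is unique.
\<close>

lemma graded_iso_shift_act:
  assumes nonzero: "\<And>k. e k \<noteq> 0"
    and V: "\<And>k. V k = range (\<lambda>c. scale c (e k))"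
    and action: "\<And>m n k. (m, n) \<noteq> (0, 0) \<Longrightarrow>
      act (Poly_Mapping.single (m, n) 1) (e k) = scale (c m n k) (e (k + m))"
  shows "qvir_graded_iso scale act V fscale (shift_act c) line"
proof -
  let ?g = "combination e"
  have in_V: "scale a (e k) \<in> V k" for a k using V by blast
  have "inj ?g"
  proof (rule injI)
    fix p p' assume eq: "?g p = ?g p'"
    define F where "F p = Abs_poly_mapping (\<lambda>i. scale (Poly_Mapping.lookup p i) (e i))" for p
    have lookup_F: "Poly_Mapping.lookup (F p) i = scale (Poly_Mapping.lookup p i) (e i)" for p i
      unfolding F_def by (subst lookup_Abs_poly_mapping) (simp_all add: nonzero)
    then have keys_F: "Poly_Mapping.keys (F p) = Poly_Mapping.keys p" for p
      by (auto simp: in_keys_iff nonzero)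
    have "(\<Sum>i\<in>Poly_Mapping.keys (F p). Poly_Mapping.lookup (F p) i) = ?g p" for p
      by (simp add: lookup_F keys_F combination_def)
    then have "F p = F p'"
      using unique_homogeneous_components[of "?g p"] eq in_V lookup_F by metis
    then have "scale (Poly_Mapping.lookup p i) (e i) = scale (Poly_Mapping.lookup p' i) (e i)" for i
      by (metis lookup_F)
    then show "p = p'" by (intro poly_mapping_eqI) (simp add: nonzero)
  qed
  moreover have "surj ?g"
  proof (rule surjI[of _ "\<lambda>v. SOME p. ?g p = v"], rule someI_ex)
    fix v
    obtain F where F: "\<And>i. Poly_Mapping.lookup F i \<in> V i"
      and v: "v = (\<Sum>i\<in>Poly_Mapping.keys F. Poly_Mapping.lookup F i)"
      using unique_homogeneous_components[of v] by blast
    have "\<exists>a. Poly_Mapping.lookup F i = scale a (e i)" for i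
      using F[of i] V[of i] by auto
    then obtain a where a: "\<And>i. Poly_Mapping.lookup F i = scale (a i) (e i)" by metis
    then have a_keys: "a i \<noteq> 0 \<longleftrightarrow> i \<in> Poly_Mapping.keys F" for i
      by (simp add: in_keys_iff nonzero)
    have lookup_a: "Poly_Mapping.lookup (Abs_poly_mapping a) = a"
      by (rule lookup_Abs_poly_mapping) (simp add: a_keys)
    then have "Poly_Mapping.keys (Abs_poly_mapping a) = Poly_Mapping.keys F"
      by (auto simp: a_keys keys.rep_eq)
    then have "?g (Abs_poly_mapping a) = v"
      by (simp add: combination_def lookup_a v a)
    then show "\<exists>p. ?g p = v" ..
  qed
  ultimately have bij: "bij ?g" by (simp add: bij_def)
  let ?f = "inv ?g"
  have f_eq: "?f v = p \<longleftrightarrow> v = ?g p" for v p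
    using bij by (metis bij_inv_eq_iff)
  have g_f: "?g (?f v) = v" for v using f_eq by metis
  have intertwine: "?g (shift_act c x p) = act x (?g p)" if "x \<in> qvir" for x p
  proof -
    have "act x (?g p) = (\<Sum>u\<in>Poly_Mapping.keys x. \<Sum>k\<in>Poly_Mapping.keys p.
        scale (Poly_Mapping.lookup x u)
          (scale (Poly_Mapping.lookup p k) (act (Poly_Mapping.single u 1) (e k))))"
      unfolding act_expand[OF that] combination_def[of _ x]
    proof (rule sum.cong[OF refl])
      fix u assume "u \<in> Poly_Mapping.keys x"
      then have "u \<noteq> (0, 0)" using that by (auto simp: qvir_def)
      then have "Poly_Mapping.single u 1 \<in> qvir" using qvir_single[of "fst u" "snd u"] by simp
      then show "scale (Poly_Mapping.lookup x u) (act (Poly_Mapping.single u 1) (?g p))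
          = (\<Sum>k\<in>Poly_Mapping.keys p. scale (Poly_Mapping.lookup x u)
              (scale (Poly_Mapping.lookup p k) (act (Poly_Mapping.single u 1) (e k))))"
        by (simp only: combination_def act_sum_right act_scale_right scale_sum_right)
    qed
    also have "\<dots> = ?g (shift_act c x p)"
      unfolding shift_act_def combination_sum
    proof (rule sum.cong[OF refl])
      fix u assume u: "u \<in> Poly_Mapping.keys x"
      obtain m n where mn: "u = (m, n)" by fastforce
      then have "(m, n) \<noteq> (0, 0)" using that u by (auto simp: qvir_def)
      then show "(\<Sum>k\<in>Poly_Mapping.keys p. scale (Poly_Mapping.lookup x u)
              (scale (Poly_Mapping.lookup p k) (act (Poly_Mapping.single u 1) (e k))))
          = ?g (case u of (m, n) \<Rightarrow> \<Sum>k\<in>Poly_Mapping.keys p. Poly_Mapping.single (k + m)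
              (Poly_Mapping.lookup x (m, n) * Poly_Mapping.lookup p k * c m n k))"
        by (simp add: mn combination_sum action mult.assoc)
    qed
    finally show ?thesis ..
  qed
  have "Vector_Spaces.linear scale fscale ?f"
    unfolding Vector_Spaces.linear_iff
    using vector_space_axioms vector_space_fscale
    by (auto simp: f_eq combination_add combination_fscale g_f)
  moreover have "bij ?f" using bij by (rule bij_imp_bij_inv)
  moreover have "\<forall>x\<in>qvir. \<forall>v. ?f (act x v) = shift_act c x (?f v)"
    by (simp add: f_eq intertwine g_f)
  moreover have "?f ` V n = line n" for n
  proof -
    have "?g ` line n = V n"
      unfolding line_def V fscale_single by (force simp: image_iff)
    then show ?thesis using bij by (metis bij_is_inj image_inv_f_f)
  qed
  ultimately show ?thesis unfolding qvir_graded_iso_def by blast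
qed

lemma span_V: "module.span scale (\<Union>n. V n) = UNIV"
proof -
  have "v \<in> span (\<Union>n. V n)" for v
  proof -
    obtain F where F: "\<And>i. Poly_Mapping.lookup F i \<in> V i"
      and v: "v = (\<Sum>i\<in>Poly_Mapping.keys F. Poly_Mapping.lookup F i)"
      using unique_homogeneous_components[of v] by blast
    show ?thesis unfolding v by (intro span_sum span_base) (use F in blast)
  qed
  then show ?thesis by auto
qed

text \<open>The whole module is then trivial, so it is the direct sum with itself as only summand.\<close>

lemma direct_sum_of_trivial_if_coefficients_zero:
  assumes zero: "\<And>m n k. (m, n) \<noteq> (0, 0) \<Longrightarrow> coefficient m n k = 0"
  shows "direct_sum_of_trivial_modules scale act V"
proof -
  have act_V: "act (Poly_Mapping.single p 1) v = 0" if p: "p \<noteq> (0, 0)" and v: "v \<in> V k" for p v k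
  proof -
    obtain a where "v = scale a (generator k)" using v V_eq by auto
    then show ?thesis using act_homogeneous[of "fst p" "snd p" a k] zero[of "fst p" "snd p" k] p
      by simp
  qed
  have trivial: "act x v = 0" if x: "x \<in> qvir" for x v
  proof -
    obtain F where F: "\<And>i. Poly_Mapping.lookup F i \<in> V i"
      and v: "v = (\<Sum>i\<in>Poly_Mapping.keys F. Poly_Mapping.lookup F i)"
      using unique_homogeneous_components[of v] by blast
    have "act x (Poly_Mapping.lookup F i) = 0" for i
      unfolding act_expand[OF x] combination_def
    proof (rule sum.neutral, rule ballI)
      fix p assume "p \<in> Poly_Mapping.keys x"
      then have "p \<noteq> (0, 0)" using x by (auto simp: qvir_def)
      from act_V[OF this F]
      show "scale (Poly_Mapping.lookup x p) (act (Poly_Mapping.single p 1) (Poly_Mapping.lookup F i)) = 0"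
        by simp
    qed
    then show ?thesis by (simp add: v act_sum_right[OF x])
  qed
  have "qvir_graded_submodule scale act V UNIV"
    by (simp add: qvir_graded_submodule_def span_V)
  moreover have "direct_sum_of scale {UNIV} (\<lambda>W. W)"
    unfolding direct_sum_of_def
  proof (intro conjI allI ex1I)
    show "\<forall>W\<in>{UNIV}. subspace W" by simp
  next
    fix v :: 'v
    show "Poly_Mapping.keys (Poly_Mapping.single UNIV v) \<subseteq> {UNIV}" by simp
    show "\<forall>W\<in>{UNIV}. Poly_Mapping.lookup (Poly_Mapping.single UNIV v) W \<in> W" by simp
    show "v = (\<Sum>W\<in>Poly_Mapping.keys (Poly_Mapping.single UNIV v).
        Poly_Mapping.lookup (Poly_Mapping.single UNIV v) W)" by simp
  next
    fix v and f :: "'v set \<Rightarrow>\<^sub>0 'v"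
    assume f: "Poly_Mapping.keys f \<subseteq> {UNIV} \<and> (\<forall>W\<in>{UNIV}. Poly_Mapping.lookup f W \<in> W) \<and>
      v = (\<Sum>W\<in>Poly_Mapping.keys f. Poly_Mapping.lookup f W)"
    then have "v = (\<Sum>W\<in>{UNIV}. Poly_Mapping.lookup f W)"
      by (metis (no_types, lifting) finite.emptyI finite_insert in_keys_iff DiffD2 sum.mono_neutral_left)
    then show "f = Poly_Mapping.single UNIV v"
      using f by (intro poly_mapping_eqI) (auto simp: lookup_single when_def in_keys_iff)
  qed
  ultimately show ?thesis
    unfolding direct_sum_of_trivial_modules_def using trivial
    by (intro exI[of _ "{UNIV}"]) simp
qed

end

theorem theorem3p3:
  fixes q :: complex
    and scale :: "complex \<Rightarrow> 'v::ab_group_add \<Rightarrow> 'v"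
    and act :: "(int \<times> int \<Rightarrow>\<^sub>0 complex) \<Rightarrow> 'v \<Rightarrow> 'v"
    and V :: "int \<Rightarrow> 'v set"
  assumes "q \<noteq> 0"
    and "\<And>n::nat. n > 0 \<Longrightarrow> q ^ n \<noteq> 1"
    and "qvir_intermediate_series scale q act V"
  shows "(\<exists>a. a \<noteq> 0 \<and>
            (qvir_graded_iso scale act V fscale (act_I q a) line \<or>
             qvir_graded_iso scale act V fscale (act_II q a) line \<or>
             qvir_graded_iso scale act V fscale (act_III q a) line \<or>
             qvir_graded_iso scale act V fscale (act_IV q a) line)) \<or>
         direct_sum_of_trivial_modules scale act V"
proof -
  interpret qvir_intermediate_series scale q act V by fact
  have powi: "q powi l = 1 \<longleftrightarrow> l = 0" for l :: int
  proof
    assume "q powi l = 1"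
    then have "q ^ nat \<bar>l\<bar> = 1"
      by (auto simp: power_int_def abs_if power_inverse split: if_splits)
    then show "l = 0" using assms(2)[of "nat \<bar>l\<bar>"] by fastforce
  qed simp
  interpret coefficients: qvir_coefficients q coefficient
    by unfold_locales (use assms(1) powi coefficient_bracket in auto)
  have iso: "qvir_graded_iso scale act V fscale (shift_act c) line"
    if r: "\<And>k. r k \<noteq> 0" and c: "\<And>k. c 1 0 k \<noteq> 0"
      and eq: "\<And>m n k. (m, n) \<noteq> (0, 0) \<Longrightarrow> coefficient m n k * r k = c m n k * r (k + m)"
    for r c
  proof (rule graded_iso_shift_act)
    fix k
    \<comment> \<open>No \<open>V k\<close> is 0, since \<open>t\<^sub>1\<close> acts on it by a nonzero coefficient.\<close>
    have "coefficient 1 0 k * r k \<noteq> 0" using eq[of 1 0 k] r c by simp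
    then have "generator k \<noteq> 0" by (auto simp: coefficient_def)
    then show "scale (r k) (generator k) \<noteq> 0" using r by simp
    have surj: "range (\<lambda>a. a * r k) = UNIV"
      using r by (intro surjI[of _ "\<lambda>a. a / r k"]) simp
    have "range (\<lambda>a. scale a (scale (r k) (generator k)))
        = (\<lambda>a. scale a (generator k)) ` range (\<lambda>a. a * r k)"
      by (simp only: image_image scale_scale)
    then show "V k = range (\<lambda>a. scale a (scale (r k) (generator k)))"
      by (simp only: surj V_eq[of k])
  next
    fix m n k :: int
    assume "(m, n) \<noteq> (0, 0)"
    then show "act (Poly_Mapping.single (m, n) 1) (scale (r k) (generator k))
        = scale (c m n k) (scale (r (k + m)) (generator (k + m)))"
      using eq[of m n k] by (simp add: act_homogeneous mult.commute)
  qed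
  from coefficients.classification show ?thesis
  proof (elim disjE exE conjE)
    assume "\<forall>m n k. (m, n) \<noteq> (0, 0) \<longrightarrow> coefficient m n k = 0"
    then show ?thesis using direct_sum_of_trivial_if_coefficients_zero by blast
  next
    fix \<alpha> r
    assume \<alpha>: "\<alpha> \<noteq> 0" and r: "\<forall>k. r k \<noteq> 0" and eq: "\<forall>m n k. (m, n) \<noteq> (0, 0) \<longrightarrow>
      coefficient m n k * r k = (\<alpha> * q powi k) powi n * r (k + m)"
    have "qvir_graded_iso scale act V fscale (act_I q \<alpha>) line"
      unfolding act_I_def by (rule iso[of r]) (use r eq in auto)
    then show ?thesis using \<alpha> by blast
  next
    fix \<alpha> r
    assume \<alpha>: "\<alpha> \<noteq> 0" and r: "\<forall>k. r k \<noteq> 0" and eq: "\<forall>m n k. (m, n) \<noteq> (0, 0) \<longrightarrow>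
      coefficient m n k * r k = (-1) powi (n + 1) * (\<alpha> * q powi (- k - m)) powi n * r (k + m)"
    have "qvir_graded_iso scale act V fscale (act_IV q \<alpha>) line"
      unfolding act_IV_def by (rule iso[of r]) (use r eq in auto)
    then show ?thesis using \<alpha> by blast
  qed
qed

end
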